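(* A connected cubic graph $G$ satisfies $\alpha(G)=\mu(G)$ if and only if $G$ is special.
   Context: All graphs are finite, simple and undirected; $\alpha(G)$ is the independence number and $\mu(G)$ the matching number of $G$; $[\ell]=\{1,\ldots,\ell\}$. A graph $B$ is a bubble with contact vertex $z$ and partition $(I,R)$ if $z\in V(B)$ and $V(B)$ is partitioned into two sets $I$ and $R$ such that: every vertex in $V(B)\setminus\{z\}$ has degree $3$ in $B$ and $z$ has degree $2$ in $B$; $I$ is independent in $B$; and $z\in R$ and $B[R]$ contains exactly one edge. A graph $G$ is special if it is connected, cubic, and its vertex set can be partitioned into sets $V_0,V_1,\ldots,V_\ell$ (for some $\ell\geq 0$) such that: the induced subgraph $G[V_0]$ is a non-empty bipartite graph with partite sets $I_0$ and $R_0$ such that every vertex in $R_0$ has degree $3$ in $G[V_0]$; and for every $i\in[\ell]$, the induced subgraph $G[V_i]$ is a $2$-connected bubble with some contact vertex $z_i$. *)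

theory Defs
  imports "Graph_Theory.Graph_Theory" "HOL-Library.Disjoint_Sets"
begin

text \<open>
  A finite simple undirected graph is an element of the locale \<^locale>\<open>graph\<close>: a finite symmetric
  digraph without loops and parallel arcs. Every undirected edge is thus represented by two
  opposite arcs, and the degree of a vertex is its \<^const>\<open>out_degree\<close>. Note that
  \<^const>\<open>connected\<close> graphs are non-empty by definition.
\<close>

definition cubic :: "('a, 'b) pre_digraph \<Rightarrow> bool" where
  "cubic G \<longleftrightarrow> (\<forall>v \<in> verts G. out_degree G v = 3)"

definition uedges :: "('a, 'b) pre_digraph \<Rightarrow> 'a set set" where
  "uedges G = {{u, v} | u v. u \<rightarrow>\<^bsub>G\<^esub> v}"

definition independent_set :: "('a, 'b) pre_digraph \<Rightarrow> 'a set \<Rightarrow> bool" where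
  "independent_set G S \<longleftrightarrow> S \<subseteq> verts G \<and> (\<forall>u \<in> S. \<forall>v \<in> S. \<not> u \<rightarrow>\<^bsub>G\<^esub> v)"

definition independence_number :: "('a, 'b) pre_digraph \<Rightarrow> nat" where
  "independence_number G = Max (card ` {S. independent_set G S})"

definition matching :: "('a, 'b) pre_digraph \<Rightarrow> 'a set set \<Rightarrow> bool" where
  "matching G M \<longleftrightarrow> M \<subseteq> uedges G \<and> disjoint M"

definition matching_number :: "('a, 'b) pre_digraph \<Rightarrow> nat" where
  "matching_number G = Max (card ` {M. matching G M})"

text \<open>Either partite set may be empty.\<close>

definition bipartition :: "('a, 'b) pre_digraph \<Rightarrow> 'a set \<Rightarrow> 'a set \<Rightarrow> bool" where
  "bipartition G I R \<longleftrightarrow>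
     I \<union> R = verts G \<and> I \<inter> R = {} \<and> independent_set G I \<and> independent_set G R"

definition two_connected :: "('a, 'b) pre_digraph \<Rightarrow> bool" where
  "two_connected G \<longleftrightarrow> card (verts G) > 2 \<and> connected G \<and>
     (\<forall>v \<in> verts G. connected (pre_digraph.del_vert G v))"

definition bubble :: "('a, 'b) pre_digraph \<Rightarrow> 'a \<Rightarrow> 'a set \<Rightarrow> 'a set \<Rightarrow> bool" where
  "bubble B z I R \<longleftrightarrow> graph B \<and>
     z \<in> verts B \<and> I \<union> R = verts B \<and> I \<inter> R = {} \<and>
     (\<forall>v \<in> verts B - {z}. out_degree B v = 3) \<and> out_degree B z = 2 \<and>
     independent_set B I \<and>
     z \<in> R \<and> card (uedges (B \<restriction> R)) = 1"

definition special :: "('a, 'b) pre_digraph \<Rightarrow> bool" where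
  "special G \<longleftrightarrow> graph G \<and> connected G \<and> cubic G \<and>
     (\<exists>(l :: nat) (V :: nat \<Rightarrow> 'a set).
        (\<Union>i \<in> {0..l}. V i) = verts G \<and> disjoint_family_on V {0..l} \<and>
        V 0 \<noteq> {} \<and>
        (\<exists>I\<^sub>0 R\<^sub>0. bipartition (G \<restriction> V 0) I\<^sub>0 R\<^sub>0 \<and>
           (\<forall>v \<in> R\<^sub>0. out_degree (G \<restriction> V 0) v = 3)) \<and>
        (\<forall>i \<in> {1..l}. two_connected (G \<restriction> V i) \<and> (\<exists>z I R. bubble (G \<restriction> V i) z I R)))"

end

theory Submission
  imports Defs
begin

text \<open>
  Write \<open>N(X)\<close> for the set of neighbours of \<open>X\<close>. By Hall's theorem every independent set of a cubic
  graph can be matched into its complement, so the independence number is at most the matching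
  number. In a special graph the sets \<open>I\<^sub>0\<close> and \<open>I\<close> of the bubbles form an independent set, and every
  edge meets \<open>I\<^sub>0\<close> or lies in a bubble of order \<open>2|I| + 1\<close>, which bounds every matching by the size
  of that set.

  Conversely, let \<open>I\<close> be independent and as large as a maximum matching. A nonempty \<open>X \<subseteq> I\<close> with
  \<open>|N(X)| \<le> |X|\<close> makes \<open>G\<close> bipartite. Otherwise every edge \<open>rs\<close> outside \<open>I\<close> lies in \<open>N(X)\<close> for some
  tight \<open>X\<close>, that is, \<open>|N(X)| = |X| + 1\<close>, since \<open>rs\<close> does not extend any matching of \<open>I\<close>. Counting
  degrees, \<open>X \<union> N(X)\<close> is a bubble. By submodularity, bubbles of different edges are disjoint,
  and choosing \<open>X\<close> minimal makes the bubble 2-connected.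
\<close>

section \<open>Hall's theorem\<close>

text \<open>Induction on \<open>A\<close>. If some nonempty proper subset \<open>X\<close> sees at
  most \<open>card X\<close> values, \<open>X\<close> is matched by itself and \<open>A - X\<close>
  into the values that \<open>X\<close> does not see. Otherwise every such subset has a value to
  spare, so one element may take any of its values.\<close>

lemma hall:
  assumes "finite A" and "\<And>a. a \<in> A \<Longrightarrow> finite (N a)"
    and "\<And>X. X \<subseteq> A \<Longrightarrow> card X \<le> card (\<Union> (N ` X))"
  shows "\<exists>f. inj_on f A \<and> (\<forall>a \<in> A. f a \<in> N a)"
  using assms
proof (induction A arbitrary: N rule: finite_psubset_induct)
  case (psubset A)
  have finU: "finite (\<Union> (N ` X))" if "X \<subseteq> A" for X
    using that psubset.hyps psubset.prems(1) by (auto intro: finite_subset)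
  show ?case
  proof (cases "\<exists>X. X \<subset> A \<and> X \<noteq> {} \<and> card (\<Union> (N ` X)) \<le> card X")
    case True
    then obtain X where X: "X \<subset> A" "X \<noteq> {}" "card (\<Union> (N ` X)) \<le> card X" by blast
    have finX: "finite X" using X(1) psubset.hyps by (auto intro: finite_subset)
    obtain f where f: "inj_on f X" "\<forall>a \<in> X. f a \<in> N a"
      using psubset.IH[OF X(1), of N] psubset.prems X(1) by (auto simp: subset_iff psubset_eq)
    have "\<exists>g. inj_on g (A - X) \<and> (\<forall>a \<in> A - X. g a \<in> N a - \<Union> (N ` X))"
    proof (rule psubset.IH)
      show "A - X \<subset> A" using X by blast
      show "finite (N a - \<Union> (N ` X))" if "a \<in> A - X" for a
        using that psubset.prems(1) by auto
      fix Y assume Y: "Y \<subseteq> A - X"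
      have finY: "finite Y" using Y psubset.hyps by (auto intro: finite_subset)
      \<comment> \<open>Hall's condition for \<open>Y \<union> X\<close>: at most
        \<open>card X\<close> of the values seen belong to \<open>X\<close>, so \<open>Y\<close>
        retains enough others.\<close>
      have "card Y + card X = card (Y \<union> X)"
        using Y finX finY by (intro card_Un_disjoint[symmetric]) auto
      also have "\<dots> \<le> card (\<Union> (N ` (Y \<union> X)))"
        using Y X(1) by (intro psubset.prems(2)) auto
      also have "\<Union> (N ` (Y \<union> X)) = (\<Union>a \<in> Y. N a - \<Union> (N ` X)) \<union> \<Union> (N ` X)" by auto
      also have "card \<dots> \<le> card (\<Union>a \<in> Y. N a - \<Union> (N ` X)) + card (\<Union> (N ` X))"
        by (rule card_Un_le)
      finally show "card Y \<le> card (\<Union>a \<in> Y. N a - \<Union> (N ` X))" using X(3) by simp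
    qed
    then obtain g where g: "inj_on g (A - X)" "\<forall>a \<in> A - X. g a \<in> N a - \<Union> (N ` X)" by blast
    define h where "h = (\<lambda>a. if a \<in> X then f a else g a)"
    have "inj_on h A"
    proof (rule inj_onI)
      fix a b assume ab: "a \<in> A" "b \<in> A" "h a = h b"
      have "a \<in> X \<longleftrightarrow> b \<in> X"
        using ab f(2) g(2) unfolding h_def by (metis Diff_iff UN_I)
      then show "a = b"
        using ab inj_onD[OF f(1), of a b] inj_onD[OF g(1), of a b] unfolding h_def
        by (auto split: if_splits)
    qed
    moreover have "\<forall>a \<in> A. h a \<in> N a" using f g unfolding h_def by auto
    ultimately show ?thesis by blast
  next
    case False
    show ?thesis
    proof (cases "A = {}")
      case False
      then obtain a where a: "a \<in> A" by blast
      have "card (\<Union> (N ` {a})) \<ge> card {a}" using a by (intro psubset.prems(2)) auto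
      then have "card (N a) \<noteq> 0" by simp
      then obtain b where b: "b \<in> N a" by fastforce
      have "\<exists>g. inj_on g (A - {a}) \<and> (\<forall>c \<in> A - {a}. g c \<in> N c - {b})"
      proof (rule psubset.IH)
        show "A - {a} \<subset> A" using a by blast
        show "finite (N c - {b})" if "c \<in> A - {a}" for c using that psubset.prems(1) by auto
        fix Y assume Y: "Y \<subseteq> A - {a}"
        show "card Y \<le> card (\<Union>c \<in> Y. N c - {b})"
        proof (cases "Y = {}")
          case False
          \<comment> \<open>\<open>Y\<close> is nonempty and lacks \<open>a\<close>, so the case
            assumption gives it one spare value, which pays for the loss of
            \<open>b\<close>.\<close>
          then have "card Y < card (\<Union> (N ` Y))"
            using Y a \<open>\<not> (\<exists>X. X \<subset> A \<and> X \<noteq> {} \<and> card (\<Union> (N ` X)) \<le> card X)\<close>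
            by (metis Diff_insert_absorb Diff_subset linorder_not_le mk_disjoint_insert
                psubsetI subset_Diff_insert subset_trans)
          also have "\<dots> \<le> card (insert b (\<Union>c \<in> Y. N c - {b}))"
            using Y finU by (intro card_mono finite.insertI finite_subset[OF _ finU[of Y]]) auto
          also have "\<dots> \<le> Suc (card (\<Union>c \<in> Y. N c - {b}))" by (rule card_insert_le_m1) simp_all
          finally show ?thesis by simp
        qed simp
      qed
      then obtain g where g: "inj_on g (A - {a})" "\<forall>c \<in> A - {a}. g c \<in> N c - {b}" by blast
      have "inj_on (g(a := b)) A"
        using g unfolding inj_on_def by auto
      moreover have "\<forall>c \<in> A. (g(a := b)) c \<in> N c" using g b by auto
      ultimately show ?thesis by blast
    qed simp
  qed
qed

text \<open>A choice of one point of \<open>S\<close> in each member of \<open>M\<close> is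
  injective by disjointness. This will bound the number of matching edges that meet
  \<open>I0\<close>.\<close>

lemma card_disjoint_hitting:
  assumes "disjoint M" and "finite S" and "\<And>e. e \<in> M \<Longrightarrow> e \<inter> S \<noteq> {}"
  shows "card M \<le> card S"
proof -
  have "\<forall>e \<in> M. \<exists>x. x \<in> e \<inter> S" using assms(3) by blast
  then obtain f where f: "\<And>e. e \<in> M \<Longrightarrow> f e \<in> e \<inter> S" by metis
  have "inj_on f M"
  proof (rule inj_onI)
    fix e e' assume "e \<in> M" "e' \<in> M" "f e = f e'"
    then show "e = e'" using f[of e] f[of e'] disjointD[OF assms(1), of e e'] by auto
  qed
  then show ?thesis using f assms(2) by (intro card_inj_on_le[of f M S]) auto
qed

section \<open>Neighbourhoods, connectivity and matchings\<close>

definition neighbors :: "('a, 'b) pre_digraph \<Rightarrow> 'a \<Rightarrow> 'a set" where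
  "neighbors G v = {u. v \<rightarrow>\<^bsub>G\<^esub> u}"

lemma neighbors_iff [simp]: "u \<in> neighbors G v \<longleftrightarrow> v \<rightarrow>\<^bsub>G\<^esub> u"
  by (simp add: neighbors_def)

lemma dominates_induce_iff [simp]:
  "u \<rightarrow>\<^bsub>G \<restriction> S\<^esub> v \<longleftrightarrow> u \<in> S \<and> v \<in> S \<and> u \<rightarrow>\<^bsub>G\<^esub> v"
  by (auto simp: arcs_ends_conv image_iff)

lemma induce_induce: "T \<subseteq> S \<Longrightarrow> (G \<restriction> S) \<restriction> T = G \<restriction> T"
  by (auto simp: induce_subgraph_def)

text \<open>Turns the vertex deletions in \<open>two_connected\<close> into induced subgraphs of the
  original graph.\<close>

lemma del_vert_induce: "pre_digraph.del_vert (G \<restriction> S) v = G \<restriction> (S - {v})"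
  by (auto simp: induce_subgraph_def pre_digraph.del_vert_def)

lemma (in digraph) out_degree_eq_card_neighbors: "out_degree G v = card (neighbors G v)"
proof -
  have "inj_on (head G) (out_arcs G v)"
    by (auto simp: inj_on_def arc_to_ends_def intro: no_multi_arcs)
  moreover have "head G ` out_arcs G v = neighbors G v"
    by (auto simp: arcs_ends_conv image_iff intro!: bexI)
  ultimately show ?thesis unfolding out_degree_def by (metis card_image)
qed

text \<open>The set of vertices reachable from a vertex is closed under adjacency, and every closed
  set containing the vertex includes it. Later connectivity arguments therefore need no
  walks.\<close>

lemma (in sym_digraph) connected_iff_closed_sets:
  "Digraph_Component.connected G \<longleftrightarrow> verts G \<noteq> {} \<and>
     (\<forall>K \<subseteq> verts G. K \<noteq> {} \<longrightarrow> (\<forall>u \<in> K. \<forall>v. u \<rightarrow> v \<longrightarrow> v \<in> K) \<longrightarrow> K = verts G)"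
    (is "?L \<longleftrightarrow> ?R")
proof -
  have conn: "?L \<longleftrightarrow> verts G \<noteq> {} \<and> (\<forall>u \<in> verts G. \<forall>v \<in> verts G. u \<rightarrow>\<^sup>* v)"
    unfolding connected_def strongly_connected_def
    by (simp add: reachable_mk_symmetric_eq[OF sym_arcs])
  show ?thesis
  proof
    assume L: ?L
    show ?R
    proof (intro conjI allI impI)
      show "verts G \<noteq> {}" using L conn by blast
      fix K assume K: "K \<subseteq> verts G" "K \<noteq> {}" "\<forall>u \<in> K. \<forall>v. u \<rightarrow> v \<longrightarrow> v \<in> K"
      then obtain u where u: "u \<in> K" by blast
      have "v \<in> K" if "v \<in> verts G" for v
      proof -
        have "u \<rightarrow>\<^sup>* v" using L conn K u that by blast
        then show ?thesis using u K(3) by (induction rule: reachable_induct) auto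
      qed
      then show "K = verts G" using K by blast
    qed
  next
    assume R: ?R
    have "u \<rightarrow>\<^sup>* v" if "u \<in> verts G" "v \<in> verts G" for u v
    proof -
      have "{w. u \<rightarrow>\<^sup>* w} = verts G"
        using R that(1)
        by (metis (mono_tags, lifting) empty_iff mem_Collect_eq reachable_adj_trans
            reachable_in_verts(2) reachable_refl subsetI)
      then show ?thesis using that by blast
    qed
    then show ?L using R conn by blast
  qed
qed

context graph
begin

lemma adj_commute: "u \<rightarrow> v \<longleftrightarrow> v \<rightarrow> u"
  using graph_symmetric by blast

lemma neighbors_subset: "neighbors G v \<subseteq> verts G"
  using adj_in_verts by auto

lemma finite_neighbors [simp]: "finite (neighbors G v)"
  using neighbors_subset finite_verts by (rule finite_subset)

lemma graph_induce: "S \<subseteq> verts G \<Longrightarrow> graph (G \<restriction> S)"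
  by (meson digraphI_induced induced_induce induced_graph_imp_symmetric digraph.graphI sym_arcs)

lemma neighbors_induce: "v \<in> S \<Longrightarrow> neighbors (G \<restriction> S) v = neighbors G v \<inter> S"
  by auto

lemma out_degree_induce:
  assumes "S \<subseteq> verts G" "v \<in> S"
  shows "out_degree (G \<restriction> S) v = card (neighbors G v \<inter> S)"
proof -
  interpret H: graph "G \<restriction> S" using assms(1) by (rule graph_induce)
  show ?thesis using assms(2) by (simp add: H.out_degree_eq_card_neighbors neighbors_induce)
qed

lemma connected_induceI:
  assumes "S \<subseteq> verts G" "S \<noteq> {}"
    and "\<And>K. \<lbrakk>K \<subseteq> S; K \<noteq> {}; S - K \<noteq> {}; \<And>u v. \<lbrakk>u \<in> K; v \<in> S - K\<rbrakk> \<Longrightarrow> \<not> u \<rightarrow> v\<rbrakk> \<Longrightarrow> False"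
  shows "Digraph_Component.connected (G \<restriction> S)"
proof -
  interpret H: graph "G \<restriction> S" using assms(1) by (rule graph_induce)
  show ?thesis
    unfolding H.connected_iff_closed_sets
  proof (intro conjI allI impI)
    show "verts (G \<restriction> S) \<noteq> {}" using assms(2) by simp
    fix K assume K: "K \<subseteq> verts (G \<restriction> S)" "K \<noteq> {}" "\<forall>u \<in> K. \<forall>v. u \<rightarrow>\<^bsub>G \<restriction> S\<^esub> v \<longrightarrow> v \<in> K"
    then show "K = verts (G \<restriction> S)" using assms(3)[of K] by auto
  qed
qed

text \<open>Double counting of the adjacent pairs in \<open>A \<times> B\<close>; the two sets may
  overlap.\<close>

lemma sum_card_neighbors_swap:
  assumes "finite A" "finite B"
  shows "(\<Sum>a \<in> A. card (neighbors G a \<inter> B)) = (\<Sum>b \<in> B. card (neighbors G b \<inter> A))"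
proof -
  have eq: "card (neighbors G a \<inter> C) = (\<Sum>c \<in> C. if a \<rightarrow> c then 1 else 0)" if "finite C" for a C
  proof -
    have "neighbors G a \<inter> C = {c \<in> C. a \<rightarrow> c}" by auto
    then show ?thesis using that by (simp add: sum.If_cases Int_def)
  qed
  show ?thesis
    unfolding eq[OF assms(1)] eq[OF assms(2)] by (subst sum.swap) (simp add: adj_commute)
qed

section \<open>Matchings and independent sets of extremal size\<close>

lemma finite_uedges: "finite (uedges G)"
  by (rule finite_subset[of _ "Pow (verts G)"]) (auto simp: uedges_def adj_in_verts)

lemma finite_matchings: "finite {M. matching G M}"
  by (rule finite_subset[of _ "Pow (uedges G)"]) (auto simp: matching_def finite_uedges)

lemma finite_independent_sets: "finite {S. independent_set G S}"
  by (rule finite_subset[of _ "Pow (verts G)"]) (auto simp: independent_set_def)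

text \<open>The edges \<open>{a, f a}\<close> are distinct and disjoint, as \<open>f\<close> is
  injective with values outside \<open>A\<close>. In this form the injections from Hall's theorem
  become matchings.\<close>

lemma card_le_matching_number:
  assumes "inj_on f A" and "f ` A \<inter> A = {}" and "\<And>a. a \<in> A \<Longrightarrow> a \<rightarrow> f a"
  shows "card A \<le> matching_number G"
proof -
  let ?M = "(\<lambda>a. {a, f a}) ` A"
  have inj: "inj_on (\<lambda>a. {a, f a}) A"
    using assms(2) by (auto simp: inj_on_def doubleton_eq_iff)
  have "disjoint ?M"
    using assms(1,2) by (auto simp: disjoint_def inj_on_def)
  then have "matching G ?M"
    unfolding matching_def uedges_def using assms(3) by auto
  then have "card ?M \<le> matching_number G"
    unfolding matching_number_def by (intro Max_ge finite_imageI finite_matchings) auto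
  then show ?thesis using inj by (simp add: card_image)
qed

lemma independent_set_induce:
  "S \<subseteq> verts G \<Longrightarrow> independent_set (G \<restriction> S) X \<longleftrightarrow> X \<subseteq> S \<and> independent_set G X"
  unfolding independent_set_def dominates_induce_iff induce_subgraph_verts by blast

lemma independent_set_mono: "independent_set G S \<Longrightarrow> T \<subseteq> S \<Longrightarrow> independent_set G T"
  unfolding independent_set_def by blast

lemma card_le_independence_number:
  "independent_set G S \<Longrightarrow> card S \<le> independence_number G"
  unfolding independence_number_def by (intro Max_ge finite_imageI finite_independent_sets) auto

lemma maximum_independent_set:
  obtains S where "independent_set G S" "card S = independence_number G"
proof -
  have "independent_set G {}" by (simp add: independent_set_def)
  then have "independence_number G \<in> card ` {S. independent_set G S}"
    unfolding independence_number_def by (intro Max_in finite_imageI finite_independent_sets) auto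
  then show ?thesis using that by auto
qed

lemma maximum_matching:
  obtains M where "matching G M" "card M = matching_number G"
proof -
  have "matching G {}" by (simp add: matching_def disjoint_def)
  then have "matching_number G \<in> card ` {M. matching G M}"
    unfolding matching_number_def by (intro Max_in finite_imageI finite_matchings) auto
  then show ?thesis using that by auto
qed

end

section \<open>Counting arcs around a neighbourhood in a cubic graph\<close>

locale cubic_graph = graph +
  assumes cubic: "cubic G"
begin

abbreviation N :: "'a \<Rightarrow> 'a set" where "N \<equiv> neighbors G"

abbreviation NS :: "'a set \<Rightarrow> 'a set" where "NS X \<equiv> \<Union> (N ` X)"

lemma card_neighbors: "v \<in> verts G \<Longrightarrow> card (N v) = 3"
  using cubic unfolding cubic_def by (simp add: out_degree_eq_card_neighbors)

lemma finite_subset_verts: "X \<subseteq> verts G \<Longrightarrow> finite X"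
  using finite_verts by (rule rev_finite_subset)

lemma NS_subset: "NS X \<subseteq> verts G"
  using neighbors_subset by auto

lemma finite_NS [simp]: "finite (NS X)"
  by (rule finite_subset_verts[OF NS_subset])

text \<open>Each vertex of \<open>X\<close> sends three arcs into \<open>NS X\<close>, and each
  vertex of \<open>NS X\<close> has three arcs, going to \<open>X\<close> or elsewhere. So
  \<open>3 * (card (NS X) - card X)\<close> arcs lead from \<open>NS X\<close> out of
  \<open>X\<close>. Arcs are ordered pairs: an edge joining two vertices of \<open>NS X\<close>
  outside \<open>X\<close> counts twice.\<close>

lemma slack_sum:
  assumes "X \<subseteq> verts G"
  shows "card (SIGMA y : NS X. N y - X) + 3 * card X = 3 * card (NS X)"
proof -
  have fin: "finite X" using assms by (rule finite_subset_verts)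
  have "3 * card X = (\<Sum>x \<in> X. card (N x \<inter> NS X))"
    using assms card_neighbors by (subst sum.cong[where h = "\<lambda>_. 3" and B = X])
      (auto intro!: arg_cong[where f = card] simp: Int_absorb2 Sup_upper)
  also have "\<dots> = (\<Sum>y \<in> NS X. card (N y \<inter> X))"
    by (rule sum_card_neighbors_swap[OF fin finite_NS])
  finally have "card (SIGMA y : NS X. N y - X) + 3 * card X
      = (\<Sum>y \<in> NS X. card (N y - X) + card (N y \<inter> X))"
    by (simp add: card_SigmaI sum.distrib)
  also have "\<dots> = (\<Sum>y \<in> NS X. 3)"
  proof (rule sum.cong[OF refl])
    fix y assume "y \<in> NS X"
    then have "card (N y) = 3" using NS_subset card_neighbors by blast
    then show "card (N y - X) + card (N y \<inter> X) = 3"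
      using card_Int_Diff[of "N y" X] by simp
  qed
  finally show ?thesis by simp
qed

lemma card_le_card_NS:
  assumes "X \<subseteq> verts G"
  shows "card X \<le> card (NS X)"
  using slack_sum[OF assms] by linarith

lemma independent_NS_disjoint:
  assumes "independent_set G I" "X \<subseteq> I"
  shows "NS X \<inter> I = {}"
  using assms unfolding independent_set_def by auto

lemma independence_le_matching: "independence_number G \<le> matching_number G"
proof -
  obtain I where I: "independent_set G I" "card I = independence_number G"
    by (rule maximum_independent_set)
  have sub: "I \<subseteq> verts G" using I(1) by (simp add: independent_set_def)
  have "\<exists>f. inj_on f I \<and> (\<forall>a \<in> I. f a \<in> N a)"
    by (intro hall card_le_card_NS finite_subset_verts[OF sub]) (use sub in auto)
  then obtain f where f: "inj_on f I" "\<forall>a \<in> I. f a \<in> N a" by blast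
  have "card I \<le> matching_number G"
  proof (rule card_le_matching_number[OF f(1)])
    show "f ` I \<inter> I = {}" using f(2) I(1) unfolding independent_set_def by auto
  qed (use f(2) in auto)
  then show ?thesis using I(2) by simp
qed

end

section \<open>Special graphs have a large independent set\<close>

context cubic_graph
begin

text \<open>The sum counts ordered pairs, and the one edge inside \<open>R\<close> supplies two of
  them.\<close>

lemma sum_neighbors_single_edge:
  assumes "R \<subseteq> verts G" and "card (uedges (G \<restriction> R)) = 1"
  shows "(\<Sum>r \<in> R. card (N r \<inter> R)) = 2"
proof -
  have ue: "uedges (G \<restriction> R) = {{u, v} | u v. u \<in> R \<and> v \<in> R \<and> u \<rightarrow> v}"
    unfolding uedges_def by auto
  obtain e where e: "uedges (G \<restriction> R) = {e}" using assms(2) by (rule card_1_singletonE)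
  then have "e \<in> {{u, v} | u v. u \<in> R \<and> v \<in> R \<and> u \<rightarrow> v}" unfolding ue by simp
  then obtain r s where rs: "e = {r, s}" "r \<in> R" "s \<in> R" "r \<rightarrow> s" by blast
  have "r \<noteq> s" using rs(4) adj_not_same by blast
  have "(SIGMA r : R. N r \<inter> R) = {(r, s), (s, r)}"
  proof (intro set_eqI iffI)
    fix p assume "p \<in> (SIGMA r : R. N r \<inter> R)"
    then obtain u v where p: "p = (u, v)" "u \<in> R" "v \<in> R" "u \<rightarrow> v" by auto
    then have "{u, v} \<in> uedges (G \<restriction> R)" unfolding ue by blast
    then have "{u, v} = {r, s}" using e rs(1) by simp
    then show "p \<in> {(r, s), (s, r)}" using p(1) by (auto simp: doubleton_eq_iff)
  qed (use rs adj_commute[of r s] in auto)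
  moreover have "card (SIGMA r : R. N r \<inter> R) = (\<Sum>r \<in> R. card (N r \<inter> R))"
    using finite_subset_verts[OF assms(1)] by (intro card_SigmaI) auto
  ultimately show ?thesis using \<open>r \<noteq> s\<close> by simp
qed

lemma neighbors_subset_if_degree_3:
  assumes "V \<subseteq> verts G" "v \<in> V" "out_degree (G \<restriction> V) v = 3"
  shows "N v \<subseteq> V"
proof -
  have "card (N v \<inter> V) = card (N v)"
    using assms card_neighbors[of v] by (auto simp: out_degree_induce)
  then have "N v \<inter> V = N v" by (intro card_subset_eq) auto
  then show ?thesis by blast
qed

text \<open>The order follows from counting the arcs from \<open>R\<close> into \<open>V\<close>
  twice, by degrees in the bubble and by the side on which they end; this gives
  \<open>card R = card I + 1\<close>. As \<open>z\<close> has degree 2 in the bubble and 3 in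
  \<open>G\<close>, exactly one edge leaves the bubble.\<close>

lemma bubble_induce:
  assumes V: "V \<subseteq> verts G" and B: "bubble (G \<restriction> V) z I R"
  shows "card V = 2 * card I + 1" and "independent_set G I" and "I \<subseteq> V - {z}" and "z \<in> V"
    and "\<And>v. v \<in> V - {z} \<Longrightarrow> N v \<subseteq> V" and "\<exists>w. N z - V = {w}"
proof -
  have IR: "I \<union> R = V" "I \<inter> R = {}" "z \<in> R" and card1: "card (uedges ((G \<restriction> V) \<restriction> R)) = 1"
    and indep: "independent_set (G \<restriction> V) I"
    and deg3: "\<forall>v \<in> V - {z}. out_degree (G \<restriction> V) v = 3" and deg2: "out_degree (G \<restriction> V) z = 2"
    using B unfolding bubble_def by auto
  show zV: "z \<in> V" and IV: "I \<subseteq> V - {z}" using IR by auto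
  have fin: "finite I" "finite R" using V IR by (auto intro: finite_subset_verts)
  show indepG: "independent_set G I"
    using indep V by (simp add: independent_set_induce)
  show closed: "N v \<subseteq> V" if "v \<in> V - {z}" for v
    using neighbors_subset_if_degree_3[OF V] that deg3 by blast
  have z2: "card (N z \<inter> V) = 2" using deg2 zV V by (simp add: out_degree_induce)
  then have "card (N z - V) = 1"
    using card_Int_Diff[of "N z" V] card_neighbors[of z] zV V by auto
  then show "\<exists>w. N z - V = {w}" by (metis card_1_singletonE)
  have "(\<Sum>r \<in> R. card (N r \<inter> V)) = (\<Sum>r \<in> R - {z}. 3) + 2"
    using fin IR z2 deg3 V
    by (subst sum.remove[of R z]) (auto simp: out_degree_induce intro!: sum.cong)
  also have "\<dots> = 3 * (card R - 1) + 2" using fin IR by simp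
  finally have 1: "(\<Sum>r \<in> R. card (N r \<inter> V)) = 3 * (card R - 1) + 2" .
  \<comment> \<open>Second count: all three arcs at each vertex of \<open>I\<close> go to
    \<open>R\<close>, and the edge inside \<open>R\<close> adds two.\<close>
  have "(\<Sum>r \<in> R. card (N r \<inter> V)) = (\<Sum>r \<in> R. card (N r \<inter> I) + card (N r \<inter> R))"
  proof (rule sum.cong[OF refl])
    fix r
    have "N r \<inter> V = (N r \<inter> I) \<union> (N r \<inter> R)" using IR by auto
    then show "card (N r \<inter> V) = card (N r \<inter> I) + card (N r \<inter> R)"
      using IR(2) by (simp add: card_Un_disjoint disjoint_iff)
  qed
  also have "\<dots> = (\<Sum>i \<in> I. card (N i \<inter> R)) + 2"
    using sum_neighbors_single_edge[of R] V IR card1 sum_card_neighbors_swap[OF fin(2,1)]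
    by (auto simp: sum.distrib induce_induce)
  also have "(\<Sum>i \<in> I. card (N i \<inter> R)) = (\<Sum>i \<in> I. 3)"
  proof (rule sum.cong[OF refl])
    fix i assume i: "i \<in> I"
    then have "N i \<subseteq> V" using closed[of i] IV by blast
    moreover have "N i \<inter> I = {}" using i indepG unfolding independent_set_def by auto
    ultimately have "N i \<inter> R = N i" using IR by blast
    then show "card (N i \<inter> R) = 3" using card_neighbors i IV V by auto
  qed
  finally have "3 * (card R - 1) + 2 = 3 * card I + 2" using 1 by simp
  moreover have "card R \<noteq> 0" using IR fin by auto
  ultimately have "card R = card I + 1" by linarith
  moreover have "card V = card I + card R"
    using IR fin card_Un_disjoint[of I R] by simp
  ultimately show "card V = 2 * card I + 1" by simp
qed

lemma card_matching_inside:
  assumes "matching G M" and "finite V" and "\<And>e. e \<in> M \<Longrightarrow> e \<subseteq> V"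
  shows "2 * card M \<le> card V"
proof -
  have two: "card e = 2" if e: "e \<in> M" for e
  proof -
    obtain u v where uv: "e = {u, v}" "u \<rightarrow> v"
      using e assms(1) unfolding matching_def uedges_def by blast
    then have "u \<noteq> v" using adj_not_same by blast
    then show ?thesis using uv(1) by simp
  qed
  have "card (\<Union> M) = sum card M"
    using assms by (intro card_Union_disjoint) (auto simp: matching_def disjoint_def pairwise_def disjnt_def intro: finite_subset)
  also have "\<dots> = 2 * card M" using two by simp
  finally show ?thesis using assms(2,3) card_mono[of V "\<Union> M"] by auto
qed

lemma matching_le_independence_if_special:
  assumes "special G"
  shows "matching_number G \<le> independence_number G"
proof -
  from assms obtain l :: nat and V I0 R0 where
    conn: "Digraph_Component.connected G"
    and cover: "(\<Union>i \<in> {0..l}. V i) = verts G" and disj: "disjoint_family_on V {0..l}"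
    and V0: "V 0 \<noteq> {}" and bip: "bipartition (G \<restriction> V 0) I0 R0"
    and deg: "\<forall>v \<in> R0. out_degree (G \<restriction> V 0) v = 3"
    and "\<forall>i \<in> {1..l}. two_connected (G \<restriction> V i) \<and> (\<exists>z I R. bubble (G \<restriction> V i) z I R)"
    unfolding special_def by blast
  then have "\<forall>i \<in> {1..l}. \<exists>z I R. bubble (G \<restriction> V i) z I R" by blast
  then obtain z I R where bub: "\<And>i. i \<in> {1..l} \<Longrightarrow> bubble (G \<restriction> V i) (z i) (I i) (R i)"
    by metis
  have VG: "V i \<subseteq> verts G" if "i \<le> l" for i using cover that by auto
  have ex_index: "\<exists>i \<le> l. v \<in> V i" if "v \<in> verts G" for v
  proof -
    have "v \<in> (\<Union>i \<in> {0..l}. V i)" using that by (simp only: cover)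
    then show ?thesis by auto
  qed
  have disjD: "i = j" if "v \<in> V i" "v \<in> V j" "i \<le> l" "j \<le> l" for v i j
    using disj that unfolding disjoint_family_on_def by (metis IntI atLeastAtMost_iff empty_iff le0)
  have IR0: "I0 \<union> R0 = V 0" "independent_set G I0" "independent_set G R0"
    using bip VG[of 0] unfolding bipartition_def by (auto simp: independent_set_induce)
  have R0: "N v \<subseteq> V 0" if "v \<in> R0" for v
    using neighbors_subset_if_degree_3[of "V 0" v] VG[of 0] IR0 deg that by blast
  note bubD = bubble_induce[OF VG bub]
  \<comment> \<open>An edge leaving a bubble ends in \<open>I0\<close>. It does not end in
    \<open>R0\<close>, whose vertices have all their neighbours in \<open>V 0\<close>. If it ended
    in another bubble, it would join the two contact vertices and be the only edge leaving either
    bubble; the two bubbles would then form all of the connected graph, although \<open>V 0\<close>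
    is nonempty.\<close>
  have outer: "w \<in> I0" if i: "i \<in> {1..l}" and v: "v \<in> V i" "v \<rightarrow> w" "w \<notin> V i" for i v w
  proof -
    have "v = z i"
    proof (rule ccontr)
      assume "v \<noteq> z i"
      then have "N v \<subseteq> V i" using bubD(5)[of i v] i v(1) by auto
      then show False using v(2,3) by (meson neighbors_iff subsetD)
    qed
    have "w \<in> verts G" using v(2) adj_in_verts by blast
    then obtain j where j: "j \<le> l" "w \<in> V j" using ex_index by blast
    have ij: "i \<noteq> j" using v(3) j(2) by blast
    show ?thesis
    proof (cases "j = 0")
      case True
      have "w \<notin> R0"
      proof
        assume "w \<in> R0"
        then have "v \<in> V 0" using R0[of w] v(2) adj_commute[of v w] by auto
        then show False using disjD[of v i 0] v(1) i by auto
      qed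
      then show ?thesis using j(2) True IR0(1) by blast
    next
      case False
      then have j': "j \<in> {1..l}" using j by auto
      have "v \<notin> V j" using disjD[of v i j] v(1) i j ij by auto
      have "w = z j"
      proof (rule ccontr)
        assume "w \<noteq> z j"
        then have "N w \<subseteq> V j" using bubD(5)[of j w] j j' by auto
        then show False using v(2) \<open>v \<notin> V j\<close> by (meson adj_commute neighbors_iff subsetD)
      qed
      obtain w' where "N (z i) - V i = {w'}" using bubD(6)[of i] i by auto
      moreover have "w \<in> N (z i) - V i" using v \<open>v = z i\<close> by simp
      ultimately have Nzi: "N (z i) \<subseteq> insert w (V i)"
        by (metis Diff_iff insertCI singletonD subsetI)
      obtain v' where "N (z j) - V j = {v'}" using bubD(6)[of j] j j' by auto
      moreover have "v \<in> N (z j) - V j"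
        using v(2) \<open>v \<notin> V j\<close> \<open>w = z j\<close> adj_commute[of v w] by simp
      ultimately have Nzj: "N (z j) \<subseteq> insert v (V j)"
        by (metis Diff_iff insertCI singletonD subsetI)
      have Ni: "N u \<subseteq> insert w (V i)" if "u \<in> V i" for u
        using bubD(5)[of i u] i that Nzi by (cases "u = z i") auto
      have Nj: "N u \<subseteq> insert v (V j)" if "u \<in> V j" for u
        using bubD(5)[of j u] j j' that Nzj by (cases "u = z j") auto
      have closed: "\<forall>u \<in> V i \<union> V j. \<forall>x. u \<rightarrow> x \<longrightarrow> x \<in> V i \<union> V j"
        using Ni Nj v(1) j(2) by (metis Un_iff insertE neighbors_iff subsetD)
      have "V i \<union> V j = verts G"
        using conn closed v(1) VG[of i] VG[of j] i j unfolding connected_iff_closed_sets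
        by (metis UnCI Un_least atLeastAtMost_iff empty_iff)
      then show ?thesis using V0 VG[of 0] disjD[of _ 0 i] disjD[of _ 0 j] i j' by auto
    qed
  qed
  define A where "A = (\<Union>i \<in> {1..l}. I i)"
  have bub_closed: "N v \<subseteq> V i" "N v \<inter> I i = {}" "v \<in> V i" if "i \<in> {1..l}" "v \<in> I i" for i v
    using bubD(2,3)[of i] bubD(5)[of i v] that unfolding independent_set_def by auto
  have IV: "I i \<subseteq> V i" if "i \<in> {1..l}" for i using bub_closed(3)[OF that] by blast
  have IVG: "I0 \<subseteq> verts G" "\<And>i. i \<in> {1..l} \<Longrightarrow> I i \<subseteq> verts G"
    using IR0(1) VG[of 0] IV VG by (blast, meson atLeastAtMost_iff subset_trans)
  have "independent_set G (I0 \<union> A)"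
    unfolding independent_set_def
  proof (intro conjI ballI)
    show "I0 \<union> A \<subseteq> verts G" using IVG unfolding A_def by blast
    \<comment> \<open>The vertices of \<open>I i\<close> are not contact vertices, so their
      neighbours remain in the same bubble, outside \<open>I i\<close>.\<close>
    have cross: "\<not> v \<rightarrow> u" if "v \<in> A" "u \<in> I0 \<union> A" for u v
    proof
      assume vu: "v \<rightarrow> u"
      obtain i where i: "i \<in> {1..l}" "v \<in> I i" using \<open>v \<in> A\<close> unfolding A_def by blast
      have u: "u \<in> V i" "u \<notin> I i" using bub_closed[OF i] vu by auto
      from \<open>u \<in> I0 \<union> A\<close> consider "u \<in> V 0" | j where "j \<in> {1..l}" "u \<in> I j"
        using IR0(1) unfolding A_def by blast
      then show False
      proof cases
        case 1
        then show False using disjD[of u 0 i] u(1) i by auto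
      next
        case 2
        then show False using disjD[of u i j] u i IV[of j] by auto
      qed
    qed
    fix u v assume uv: "u \<in> I0 \<union> A" "v \<in> I0 \<union> A"
    then show "\<not> u \<rightarrow> v"
      using cross[of u v] cross[of v u] IR0(2) adj_commute unfolding independent_set_def by blast
  qed
  then have upper: "card (I0 \<union> A) \<le> independence_number G" by (rule card_le_independence_number)
  have finI: "finite I0" "\<And>i. i \<in> {1..l} \<Longrightarrow> finite (I i)"
    using IVG by (auto intro: finite_subset_verts)
  have "I0 \<inter> A = {}"
  proof (rule ccontr)
    assume "I0 \<inter> A \<noteq> {}"
    then obtain v i where "v \<in> V 0" "i \<in> {1..l}" "v \<in> V i"
      using IR0(1) IV unfolding A_def by blast
    then show False using disjD[of v 0 i] by auto
  qed
  then have "card (I0 \<union> A) = card I0 + card A"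
    using finI unfolding A_def by (intro card_Un_disjoint) auto
  also have "card A = (\<Sum>i \<in> {1..l}. card (I i))"
    unfolding A_def
  proof (rule card_UN_disjoint)
    show "\<forall>i \<in> {1..l}. \<forall>j \<in> {1..l}. i \<noteq> j \<longrightarrow> I i \<inter> I j = {}"
      using IV disjD by (metis (no_types, lifting) atLeastAtMost_iff disjoint_iff subsetD)
  qed (use finI in auto)
  finally have cardA: "card (I0 \<union> A) = card I0 + (\<Sum>i \<in> {1..l}. card (I i))" .
  obtain M where M: "matching G M" "card M = matching_number G" by (rule maximum_matching)
  have finM: "finite M"
    using M(1) finite_uedges unfolding matching_def by (auto intro: finite_subset)
  \<comment> \<open>The matching is split into edges meeting \<open>I0\<close>, bounded by hitting,
    and edges inside a bubble, bounded by its order.\<close>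
  define M0 where "M0 = {e \<in> M. e \<inter> I0 \<noteq> {}}"
  define Mi where "Mi = (\<lambda>i. {e \<in> M. e \<subseteq> V i})"
  have sub: "matching G M'" if "M' \<subseteq> M" for M'
    using M(1) that unfolding matching_def disjoint_def by blast
  have cardM0: "card M0 \<le> card I0"
    using sub[of M0] finI(1) unfolding M0_def matching_def by (intro card_disjoint_hitting) auto
  have cardMi: "card (Mi i) \<le> card (I i)" if i: "i \<in> {1..l}" for i
  proof -
    have "2 * card (Mi i) \<le> card (V i)"
      using sub[of "Mi i"] i VG[of i] unfolding Mi_def
      by (intro card_matching_inside finite_subset_verts) auto
    \<comment> \<open>The order \<open>2 * card (I i) + 1\<close> is odd, so halving loses the extra
      vertex.\<close>
    then show ?thesis using bubD(1)[of i] i by simp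
  qed
  have "M \<subseteq> M0 \<union> (\<Union>i \<in> {1..l}. Mi i)"
  proof
    fix e assume e: "e \<in> M"
    then obtain u v where uv: "e = {u, v}" "u \<rightarrow> v"
      using M(1) unfolding matching_def uedges_def by blast
    \<comment> \<open>An edge with an end in a bubble either remains inside it or has its other end
      in \<open>I0\<close>, by \<open>outer\<close>.\<close>
    have inside: "e \<in> M0 \<union> (\<Union>i \<in> {1..l}. Mi i)"
      if "x \<in> V i" "i \<in> {1..l}" "x \<rightarrow> y" "e = {x, y}" for x y i
      using outer[of i x y] that e unfolding M0_def Mi_def by (cases "y \<in> V i") auto
    obtain i where i: "i \<le> l" "u \<in> V i" using adj_in_verts(1)[OF uv(2)] ex_index by blast
    obtain j where j: "j \<le> l" "v \<in> V j" using adj_in_verts(2)[OF uv(2)] ex_index by blast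
    show "e \<in> M0 \<union> (\<Union>i \<in> {1..l}. Mi i)"
    proof (cases "i = 0 \<and> j = 0")
      case True
      then have "u \<in> I0 \<or> v \<in> I0"
        using i j IR0 uv(2) unfolding independent_set_def by blast
      then show ?thesis using e uv(1) unfolding M0_def by auto
    next
      case False
      then show ?thesis
        using inside[of u i v] inside[of v j u] i j uv adj_commute[of u v] by (auto simp: insert_commute)
    qed
  qed
  then have "card M \<le> card (M0 \<union> (\<Union>i \<in> {1..l}. Mi i))"
    using finM unfolding M0_def Mi_def by (intro card_mono) auto
  also have "\<dots> \<le> card M0 + (\<Sum>i \<in> {1..l}. card (Mi i))"
    by (intro order_trans[OF card_Un_le] add_mono card_UN_le) auto
  also have "\<dots> \<le> card I0 + (\<Sum>i \<in> {1..l}. card (I i))"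
    by (intro add_mono sum_mono cardM0 cardMi)
  finally show ?thesis using M(2) upper cardA by simp
qed

end

section \<open>Tight sets and bubbles\<close>

context cubic_graph
begin

text \<open>By \<open>slack_sum\<close> no arc leads from \<open>NS X\<close> out of
  \<open>X\<close>. Hence \<open>X \<union> NS X\<close> is closed under adjacency, so it is the
  whole graph, with bipartition \<open>X\<close> and \<open>NS X\<close>. The partition then
  consists of \<open>V 0\<close> alone, without bubbles.\<close>

lemma special_if_no_surplus:
  assumes conn: "Digraph_Component.connected G"
    and X: "independent_set G X" "X \<noteq> {}" "card (NS X) \<le> card X"
  shows "special G"
proof -
  have sub: "X \<subseteq> verts G" using X(1) by (simp add: independent_set_def)
  have "card (SIGMA y : NS X. N y - X) = 0" using slack_sum[OF sub] X(3) by linarith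
  moreover have "finite (SIGMA y : NS X. N y - X)" by (intro finite_SigmaI) auto
  ultimately have no_slack: "(SIGMA y : NS X. N y - X) = {}" by (simp only: card_0_eq)
  have N_sub_X: "N y \<subseteq> X" if "y \<in> NS X" for y
  proof
    fix x assume "x \<in> N y"
    show "x \<in> X"
    proof (rule ccontr)
      assume "x \<notin> X"
      then have "(y, x) \<in> (SIGMA y : NS X. N y - X)" using that \<open>x \<in> N y\<close> by blast
      then show False unfolding no_slack by simp
    qed
  qed
  have "\<forall>u \<in> X \<union> NS X. \<forall>v. u \<rightarrow> v \<longrightarrow> v \<in> X \<union> NS X"
    using N_sub_X by (metis UN_I Un_iff neighbors_iff subsetD)
  then have all: "X \<union> NS X = verts G"
    using conn X(2) sub NS_subset[of X] unfolding connected_iff_closed_sets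
    by (metis Un_empty Un_least)
  have disj: "NS X \<inter> X = {}" using independent_NS_disjoint[OF X(1)] by blast
  have indR: "independent_set G (NS X)"
    unfolding independent_set_def using NS_subset N_sub_X disj
    by (metis disjoint_iff neighbors_iff subsetD)
  have deg: "out_degree (G \<restriction> verts G) v = 3" if "v \<in> verts G" for v
    using that card_neighbors neighbors_subset[of v] by (simp add: out_degree_induce Int_absorb2)
  have "bipartition (G \<restriction> verts G) X (NS X)"
    unfolding bipartition_def using all disj sub NS_subset[of X] X(1) indR
    by (simp add: independent_set_induce Int_commute)
  moreover have "\<forall>v \<in> NS X. out_degree (G \<restriction> verts G) v = 3" using deg NS_subset by blast
  moreover have "graph G" by unfold_locales
  moreover have "verts G \<noteq> {}" using X(2) sub by blast
  ultimately show ?thesis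
    unfolding special_def using conn cubic
    by (intro conjI exI[of _ 0] exI[of _ "\<lambda>_. verts G"] exI[of _ X] exI[of _ "NS X"])
       (auto simp: disjoint_family_on_def)
qed

end

section \<open>Tight sets under a strict Hall condition\<close>

locale surplus_graph = cubic_graph +
  fixes I :: "'a set"
  assumes indep: "independent_set G I"
    and surplus: "\<lbrakk>X \<subseteq> I; X \<noteq> {}\<rbrakk> \<Longrightarrow> card X < card (NS X)"
    and card_I: "card I = matching_number G"
begin

text \<open>Surplus one is the least that \<open>surplus\<close> allows. By \<open>slack_sum\<close>
  it means that exactly three arcs lead from \<open>NS X\<close> out of \<open>X\<close>.\<close>

definition tight :: "'a set \<Rightarrow> bool" where
  "tight X \<longleftrightarrow> X \<subseteq> I \<and> X \<noteq> {} \<and> card (NS X) = card X + 1"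

lemma I_subset: "I \<subseteq> verts G"
  using indep by (simp add: independent_set_def)

lemma tight_subset: "tight X \<Longrightarrow> X \<subseteq> I"
  by (simp add: tight_def)

lemma tight_subset_verts: "tight X \<Longrightarrow> X \<subseteq> verts G"
  using I_subset tight_subset by blast

lemma tight_finite: "tight X \<Longrightarrow> finite X"
  using finite_subset_verts tight_subset_verts by blast

lemma tight_NS_disjoint: "tight X \<Longrightarrow> NS X \<inter> I = {}"
  using independent_NS_disjoint[OF indep] tight_subset by blast

text \<open>By tightness exactly three arcs leave \<open>NS X\<close> to a vertex outside \<open>X\<close>, and two of them belong to
  the edge \<open>rs\<close>.\<close>

lemma tight_slack:
  assumes X: "tight X" and rs: "r \<in> NS X" "s \<in> NS X" "r \<rightarrow> s"
  obtains z w where "z \<in> NS X" "w \<notin> X" "w \<notin> NS X" "z \<rightarrow> w"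
    "(SIGMA y : NS X. N y - X) = {(r, s), (s, r), (z, w)}"
proof -
  let ?S = "SIGMA y : NS X. N y - X"
  have fin: "finite ?S" by (intro finite_SigmaI) auto
  have notX: "y \<notin> X" if "y \<in> NS X" for y
    using tight_NS_disjoint[OF X] tight_subset[OF X] that by blast
  have sr: "s \<rightarrow> r" using rs(3) adj_commute[of r s] by blast
  have "r \<noteq> s" using rs(3) adj_not_same by blast
  have "card ?S = 3"
    using slack_sum[OF tight_subset_verts[OF X]] X unfolding tight_def by linarith
  moreover have "(r, s) \<in> ?S" "(s, r) \<in> ?S"
    using rs sr notX[OF rs(1)] notX[OF rs(2)] by (auto simp only: mem_Sigma_iff Diff_iff neighbors_iff)
  then have in_S: "{(r, s), (s, r)} \<subseteq> ?S" by blast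
  ultimately have "card (?S - {(r, s), (s, r)}) = 1"
    using \<open>r \<noteq> s\<close> by (simp add: card_Diff_subset)
  then obtain p where p: "?S - {(r, s), (s, r)} = {p}" by (rule card_1_singletonE)
  obtain z w where zw: "p = (z, w)" by (cases p)
  have "?S = {(r, s), (s, r)} \<union> (?S - {(r, s), (s, r)})"
    using in_S by (simp only: Un_Diff_cancel Un_absorb1)
  then have S: "?S = {(r, s), (s, r), (z, w)}" unfolding p zw by (simp only: Un_insert_left Un_empty_left)
  have "(z, w) \<in> ?S - {(r, s), (s, r)}" unfolding p zw by simp
  then have mem: "(z, w) \<in> ?S" "(z, w) \<notin> {(r, s), (s, r)}" by (simp_all only: Diff_iff simp_thms)
  then have z: "z \<in> NS X" "z \<rightarrow> w" "w \<notin> X" by auto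
  \<comment> \<open>Otherwise the reverse arc from \<open>w\<close> to \<open>z\<close> would be
    counted as well, and three arcs leave no room for it.\<close>
  have "w \<notin> NS X"
  proof
    assume w: "w \<in> NS X"
    have "w \<rightarrow> z" using z(2) adj_commute[of z w] by blast
    then have "(w, z) \<in> ?S" using w notX[OF z(1)] by auto
    then have "(w, z) \<in> {(r, s), (s, r), (z, w)}" using S by simp
    then have "w = z" using mem(2) by auto
    then show False using z(2) adj_not_same by blast
  qed
  then show ?thesis using that z S by blast
qed

text \<open>Of the three arcs leading out of \<open>X\<close>, two are the directions of
  \<open>rs\<close> and the third leaves \<open>NS X\<close>, so no second edge fits inside
  \<open>NS X\<close>.\<close>

lemma tight_unique_edge:
  assumes "tight X" "r \<in> NS X" "s \<in> NS X" "r \<rightarrow> s" "r' \<in> NS X" "s' \<in> NS X" "r' \<rightarrow> s'"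
  shows "{r, s} = {r', s'}"
proof -
  obtain z w where "z \<in> NS X" "w \<notin> X" and w: "w \<notin> NS X" and "z \<rightarrow> w"
    and S: "(SIGMA y : NS X. N y - X) = {(r, s), (s, r), (z, w)}"
    using tight_slack[OF assms(1-4)] .
  have "s' \<notin> X"
    using assms(6) tight_NS_disjoint[OF assms(1)] tight_subset[OF assms(1)] by blast
  then have "(r', s') \<in> (SIGMA y : NS X. N y - X)" using assms by simp
  then have "(r', s') \<in> {(r, s), (s, r), (z, w)}" using S by simp
  then show ?thesis using w assms(6) by auto
qed

text \<open>The surplus \<open>card (NS X) - card X\<close> is submodular. The union has surplus at
  least one, and \<open>NS X \<inter> NS Y\<close> exceeds \<open>X \<inter> Y\<close> by at least
  one. These two excesses add up to two, so both are exactly one.\<close>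

lemma tight_Un:
  assumes X: "tight X" and Y: "tight Y" and meet: "NS X \<inter> NS Y \<noteq> {}"
  shows "tight (X \<union> Y)"
proof -
  have "card (X \<inter> Y) < card (NS X \<inter> NS Y)"
  \<comment> \<open>\<open>surplus\<close> says nothing about the empty set; there the common
    neighbour from \<open>meet\<close> supplies the excess.\<close>
  proof (cases "X \<inter> Y = {}")
    case True
    then show ?thesis using meet by (simp add: card_gt_0_iff)
  next
    case False
    then have "card (X \<inter> Y) < card (NS (X \<inter> Y))"
      using X tight_subset by (intro surplus) auto
    also have "\<dots> \<le> card (NS X \<inter> NS Y)" by (intro card_mono) auto
    finally show ?thesis .
  qed
  moreover have "card (NS X) + card (NS Y) = card (NS (X \<union> Y)) + card (NS X \<inter> NS Y)"
    using card_Un_Int[OF finite_NS finite_NS, of X Y] by (simp only: image_Un Union_Un_distrib)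
  moreover have "card X + card Y = card (X \<union> Y) + card (X \<inter> Y)"
    using card_Un_Int[OF tight_finite[OF X] tight_finite[OF Y]] .
  moreover have "card (X \<union> Y) < card (NS (X \<union> Y))"
    using X Y tight_def by (intro surplus) auto
  ultimately have "card (NS (X \<union> Y)) = card (X \<union> Y) + 1"
    using X Y unfolding tight_def by linarith
  then show ?thesis using X Y unfolding tight_def by simp
qed

text \<open>Both edges lie in the neighbourhood of the tight set \<open>X \<union> Y\<close>, which
  has room for one edge only.\<close>

lemma tight_same_edge:
  assumes "tight X" "tight Y" "NS X \<inter> NS Y \<noteq> {}"
    and "r \<in> NS X" "s \<in> NS X" "r \<rightarrow> s" "r' \<in> NS Y" "s' \<in> NS Y" "r' \<rightarrow> s'"
  shows "{r, s} = {r', s'}"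
  using tight_unique_edge[OF tight_Un[OF assms(1-3)], of r s r' s'] assms(4-)
  by (simp only: image_Un Union_Un_distrib Un_iff simp_thms)

text \<open>A matching of \<open>I\<close> into the complement of \<open>I \<union> {r, s}\<close> together with the edge \<open>rs\<close> would be
  larger than a maximum matching. Hence Hall's condition fails there.\<close>

lemma ex_tight:
  assumes rs: "r \<notin> I" "s \<notin> I" "r \<rightarrow> s"
  shows "\<exists>X. tight X \<and> r \<in> NS X \<and> s \<in> NS X"
proof -
  have finI: "finite I" using I_subset by (rule finite_subset_verts)
  have "r \<noteq> s" using rs(3) adj_not_same by blast
  have "\<not> (\<forall>X \<subseteq> I. card X \<le> card (\<Union>x \<in> X. N x - {r, s}))"
  proof
    assume "\<forall>X \<subseteq> I. card X \<le> card (\<Union>x \<in> X. N x - {r, s})"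
    then have "\<exists>f. inj_on f I \<and> (\<forall>a \<in> I. f a \<in> N a - {r, s})"
      using finI by (intro hall) auto
    then obtain f where f: "inj_on f I" "\<forall>a \<in> I. f a \<in> N a - {r, s}" by blast
    have fI: "f a \<notin> I" if "a \<in> I" for a
      using f(2) that indep unfolding independent_set_def by auto
    \<comment> \<open>\<open>g\<close> matches \<open>r\<close> with \<open>s\<close> in addition,
      so that \<open>insert r I\<close>, one larger than \<open>I\<close>, is matched.\<close>
    define g where "g = f(r := s)"
    have g: "g r = s" "\<And>a. a \<in> I \<Longrightarrow> g a = f a" using rs(1) unfolding g_def by auto
    have "card (insert r I) \<le> matching_number G"
    proof (rule card_le_matching_number)
      show "inj_on g (insert r I)"
        using f g by (auto simp: inj_on_def)
      show "g ` insert r I \<inter> insert r I = {}"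
        using f g fI rs(2) \<open>r \<noteq> s\<close> by auto
      show "a \<rightarrow> g a" if "a \<in> insert r I" for a
        using that f(2) g rs(3) by auto
    qed
    then show False using finI rs(1) card_I by simp
  qed
  then obtain X where X: "X \<subseteq> I" "card (\<Union>x \<in> X. N x - {r, s}) < card X"
    by (meson linorder_not_le)
  have "X \<noteq> {}" using X(2) by auto
  have "card (NS X) = card (NS X - {r, s}) + card (NS X \<inter> {r, s})"
    using card_Int_Diff[OF finite_NS, of X "{r, s}"] by simp
  moreover have "card (NS X - {r, s}) = card (\<Union>x \<in> X. N x - {r, s})"
    by (rule arg_cong[where f = card]) blast
  moreover have "card (NS X \<inter> {r, s}) \<le> card {r, s}" by (intro card_mono) auto
  moreover have "card {r, s} = 2" using \<open>r \<noteq> s\<close> by simp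
  moreover have "card X < card (NS X)" using X(1) \<open>X \<noteq> {}\<close> by (rule surplus)
  \<comment> \<open>Removing \<open>r\<close> and \<open>s\<close> takes \<open>NS X\<close> from at
    least \<open>card X + 1\<close> elements to at most \<open>card X - 1\<close>. It removes at
    most two, so both are removed and the first bound is attained.\<close>
  ultimately have eq: "card (NS X) = card X + 1" "card (NS X \<inter> {r, s}) = card {r, s}"
    using X(2) by linarith+
  have "NS X \<inter> {r, s} = {r, s}" by (intro card_subset_eq eq(2)) auto
  then have "{r, s} \<subseteq> NS X" by (rule subset_trans[OF equalityD2 Int_lower1])
  then have "r \<in> NS X" "s \<in> NS X" by (simp_all only: insert_subset)
  moreover have "tight X" unfolding tight_def using eq(1) X(1) \<open>X \<noteq> {}\<close> by (intro conjI)
  ultimately show ?thesis by (intro exI[of _ X] conjI)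
qed

section \<open>From tight sets to 2-connected bubbles\<close>

lemma tight_bubble:
  assumes X: "tight X" and rs: "r \<in> NS X" "s \<in> NS X" "r \<rightarrow> s"
  shows "\<exists>z. bubble (G \<restriction> (X \<union> NS X)) z X (NS X)"
proof -
  obtain z w where zw: "z \<in> NS X" "w \<notin> X" "w \<notin> NS X" "z \<rightarrow> w"
    and S: "(SIGMA y : NS X. N y - X) = {(r, s), (s, r), (z, w)}"
    using tight_slack[OF X rs] .
  let ?V = "X \<union> NS X"
  have V: "?V \<subseteq> verts G" using tight_subset_verts[OF X] NS_subset by blast
  have disj: "X \<inter> NS X = {}" using tight_NS_disjoint[OF X] tight_subset[OF X] by blast
  have out: "(y, u) \<in> {(r, s), (s, r), (z, w)}" if "y \<in> NS X" "y \<rightarrow> u" "u \<notin> X" for y u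
  proof -
    have "(y, u) \<in> (SIGMA y : NS X. N y - X)" using that by simp
    then show ?thesis using S by simp
  qed
  \<comment> \<open>The contact vertex \<open>z\<close> is the start of the third arc, the only one
    leaving \<open>X \<union> NS X\<close>; every other vertex retains its three neighbours.\<close>
  have "N v \<inter> ?V = N v" if v: "v \<in> ?V" "v \<noteq> z" for v
  proof (cases "v \<in> X")
    case True
    then show ?thesis by blast
  next
    case False
    then have "v \<in> NS X" using v by blast
    then have "u \<in> ?V" if "v \<rightarrow> u" for u
      using out[of v u] that v(2) rs(1,2) by blast
    then have "N v \<subseteq> ?V" by (meson neighbors_iff subsetI)
    then show ?thesis by (rule Int_absorb2)
  qed
  then have deg3: "\<forall>v \<in> ?V - {z}. out_degree (G \<restriction> ?V) v = 3"
    using V card_neighbors by (auto simp: out_degree_induce)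
  have "N z - ?V = {w}"
  proof (intro set_eqI iffI)
    fix u assume "u \<in> N z - ?V"
    then show "u \<in> {w}" using out[of z u] zw(1) rs by auto
  qed (use zw in auto)
  then have "card (N z \<inter> ?V) = 2"
    using card_Int_Diff[of "N z" ?V] card_neighbors[of z] zw(1) NS_subset[of X] by auto
  then have deg2: "out_degree (G \<restriction> ?V) z = 2"
    using V zw(1) by (simp add: out_degree_induce)
  have "uedges (G \<restriction> NS X) = {{r, s}}"
  proof (intro set_eqI iffI)
    fix e assume "e \<in> uedges (G \<restriction> NS X)"
    then obtain u v where uv: "e = {u, v}" "u \<in> NS X" "v \<in> NS X" "u \<rightarrow> v"
      unfolding uedges_def by auto
    then show "e \<in> {{r, s}}" using tight_unique_edge[OF X rs uv(2-4)] by simp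
  qed (use rs in \<open>auto simp: uedges_def\<close>)
  then have "card (uedges ((G \<restriction> ?V) \<restriction> NS X)) = 1" by (simp add: induce_induce)
  moreover have "independent_set (G \<restriction> ?V) X"
    using independent_set_mono[OF indep tight_subset[OF X]]
    by (simp add: independent_set_induce[OF V])
  ultimately have "bubble (G \<restriction> ?V) z X (NS X)"
    unfolding bubble_def using graph_induce[OF V] zw(1) disj deg3 deg2 by simp
  then show ?thesis by blast
qed

text \<open>Shows that each side of a cut by at most one vertex meets \<open>X\<close>. A vertex of
  \<open>K \<subseteq> NS X\<close> has at most one neighbour in \<open>X\<close>, namely
  \<open>d\<close>, so at least two of the three arcs of \<open>tight_slack\<close> start there; it
  must be \<open>z\<close> and an end of \<open>rs\<close>. Its neighbour in \<open>X\<close> takes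
  up \<open>D\<close>, so the other end of \<open>rs\<close> is in \<open>K\<close> too and would
  also have to be \<open>z\<close>.\<close>

lemma no_cut_part_in_NS:
  assumes X: "tight X" and rs: "r \<in> NS X" "s \<in> NS X" "r \<rightarrow> s"
    and K: "K \<subseteq> NS X" "K \<noteq> {}" and D: "D \<subseteq> {d}"
    and closed: "\<And>u v. \<lbrakk>u \<in> K; v \<in> X \<union> NS X; u \<rightarrow> v\<rbrakk> \<Longrightarrow> v \<in> K \<union> D"
  shows False
proof -
  obtain z w where S: "(SIGMA y : NS X. N y - X) = {(r, s), (s, r), (z, w)}"
    using tight_slack[OF X rs] .
  have "r \<noteq> s" using rs(3) adj_not_same by blast
  have sr: "s \<rightarrow> r" using rs(3) adj_commute[of r s] by blast
  have disj: "X \<inter> NS X = {}" using tight_NS_disjoint[OF X] tight_subset[OF X] by blast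
  have key: "y = z \<and> (y = r \<or> y = s)" if y: "y \<in> K" for y
  proof (rule ccontr)
    assume contr: "\<not> ?thesis"
    have "N y \<inter> X \<subseteq> {d}"
    proof
      fix x assume x: "x \<in> N y \<inter> X"
      then have "x \<in> K \<union> D" using closed[OF y, of x] by simp
      then show "x \<in> {d}" using x K(1) D disj by blast
    qed
    then have "card (N y \<inter> X) \<le> 1" using card_mono[of "{d}"] by simp
    moreover have "card (N y) = 3" using y K(1) NS_subset card_neighbors by blast
    ultimately have "2 \<le> card (N y - X)" using card_Int_Diff[of "N y" X] by simp
    moreover have "\<exists>t. N y - X \<subseteq> {t}"
    proof -
      \<comment> \<open>A vertex that is not both \<open>z\<close> and an end of \<open>rs\<close>
        is the start of at most one of the three arcs.\<close>
      have "N y - X \<subseteq> {if y = r then s else if y = s then r else w}"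
      proof
        fix u assume "u \<in> N y - X"
        then have "(y, u) \<in> (SIGMA y : NS X. N y - X)" using y K(1) by (intro SigmaI) blast+
        then have "(y, u) \<in> {(r, s), (s, r), (z, w)}" using S by simp
        then show "u \<in> {if y = r then s else if y = s then r else w}"
          using contr \<open>r \<noteq> s\<close> by auto
      qed
      then show ?thesis by blast
    qed
    then have "card (N y - X) \<le> 1" by (metis card.empty card_mono finite.simps is_singletonI is_singleton_altdef)
    ultimately show False by simp
  qed
  obtain y where y: "y \<in> K" using K(2) by blast
  obtain x where x: "x \<in> X" "x \<rightarrow> y" using y K(1) by auto
  have "y \<rightarrow> x" using x(2) adj_commute[of x y] by blast
  then have "x \<in> D" using closed[OF y, of x] x(1) K(1) disj by blast
  obtain t where t: "t \<in> {r, s}" "t \<noteq> y" "y \<rightarrow> t"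
    using key[OF y] rs(3) sr \<open>r \<noteq> s\<close> by blast
  then have "t \<in> NS X" using rs by blast
  then have "t \<noteq> x" using x(1) disj by blast
  then have "t \<in> K" using closed[OF y, of t] t \<open>t \<in> NS X\<close> \<open>x \<in> D\<close> D by blast
  then show False using key[OF y] key[of t] t(2) by blast
qed

text \<open>Both \<open>K \<inter> X\<close> and \<open>L \<inter> X\<close> are nonempty and have
  surplus at least one, while \<open>X\<close> has surplus one and the two neighbourhoods share at
  most the vertex in \<open>D\<close>. This makes \<open>K \<inter> X\<close> tight with all of
  \<open>(K \<union> D) \<inter> NS X\<close> as its neighbourhood, hence with \<open>r\<close> and
  \<open>s\<close> in it, although it is smaller than \<open>X\<close>.\<close>

lemma minimal_tight_no_cut:
  assumes X: "tight X" and rs: "r \<in> NS X" "s \<in> NS X" "r \<rightarrow> s"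
    and minimal: "\<And>Y. \<lbrakk>tight Y; r \<in> NS Y; s \<in> NS Y\<rbrakk> \<Longrightarrow> card X \<le> card Y"
    and part: "K \<union> L \<union> D = X \<union> NS X" "K \<inter> L = {}" "K \<inter> D = {}" "L \<inter> D = {}"
    and ne: "K \<noteq> {}" "L \<noteq> {}" and D: "D \<subseteq> {d}"
    and sep: "\<And>u v. \<lbrakk>u \<in> K; v \<in> L\<rbrakk> \<Longrightarrow> \<not> u \<rightarrow> v"
    and rsK: "r \<in> K \<union> D" "s \<in> K \<union> D"
  shows False
proof -
  have sep': "\<not> v \<rightarrow> u" if "u \<in> K" "v \<in> L" for u v
    using sep[OF that] adj_commute[of u v] by blast
  have disj: "X \<inter> NS X = {}" using tight_NS_disjoint[OF X] tight_subset[OF X] by blast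
  have finX: "finite X" using X by (rule tight_finite)
  have "K \<inter> X \<noteq> {}"
  proof
    assume "K \<inter> X = {}"
    then show False
      using no_cut_part_in_NS[OF X rs _ ne(1) D] part(1) sep by blast
  qed
  have "L \<inter> X \<noteq> {}"
  proof
    assume "L \<inter> X = {}"
    then show False
      using no_cut_part_in_NS[OF X rs _ ne(2) D] part(1) sep' by blast
  qed
  have NK: "NS (K \<inter> X) \<subseteq> (K \<union> D) \<inter> NS X"
  proof
    fix y assume "y \<in> NS (K \<inter> X)"
    then obtain x where x: "x \<in> K" "x \<in> X" "x \<rightarrow> y" by auto
    then have "y \<in> NS X" by auto
    then show "y \<in> (K \<union> D) \<inter> NS X" using sep[OF x(1), of y] x(3) part(1) by blast
  qed
  have NL: "NS (L \<inter> X) \<subseteq> (L \<union> D) \<inter> NS X"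
  proof
    fix y assume "y \<in> NS (L \<inter> X)"
    then obtain x where x: "x \<in> L" "x \<in> X" "x \<rightarrow> y" by auto
    then have "y \<in> NS X" by auto
    then show "y \<in> (L \<union> D) \<inter> NS X" using sep'[OF _ x(1), of y] x(3) part(1) by blast
  qed
  have split: "card A = card (K \<inter> A) + card (L \<inter> A) + card (D \<inter> A)"
    if "A \<subseteq> X \<union> NS X" "finite A" for A
  proof -
    have "A = (K \<inter> A \<union> L \<inter> A) \<union> D \<inter> A" using that(1) part(1) by blast
    also have "card \<dots> = card (K \<inter> A \<union> L \<inter> A) + card (D \<inter> A)"
      using that(2) part by (intro card_Un_disjoint) auto
    also have "card (K \<inter> A \<union> L \<inter> A) = card (K \<inter> A) + card (L \<inter> A)"
      using that(2) part by (intro card_Un_disjoint) auto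
    finally show ?thesis .
  qed
  have "card (D \<inter> X) + card (D \<inter> NS X) = card (D \<inter> X \<union> D \<inter> NS X)"
    using disj finX by (intro card_Un_disjoint[symmetric]) auto
  also have "\<dots> \<le> card {d}" using D by (intro card_mono) auto
  finally have dD: "card (D \<inter> X) + card (D \<inter> NS X) \<le> 1" by simp
  have cK: "card ((K \<union> D) \<inter> NS X) \<le> card (K \<inter> NS X) + card (D \<inter> NS X)"
    and cL: "card ((L \<union> D) \<inter> NS X) \<le> card (L \<inter> NS X) + card (D \<inter> NS X)"
    unfolding Int_Un_distrib2 by (rule card_Un_le)+
  have sK: "card (K \<inter> X) < card (NS (K \<inter> X))"
    using tight_subset[OF X] \<open>K \<inter> X \<noteq> {}\<close> by (intro surplus) auto
  have sL: "card (L \<inter> X) < card (NS (L \<inter> X))"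
    using tight_subset[OF X] \<open>L \<inter> X \<noteq> {}\<close> by (intro surplus) auto
  have mK: "card (NS (K \<inter> X)) \<le> card ((K \<union> D) \<inter> NS X)"
    by (intro card_mono NK) auto
  have mL: "card (NS (L \<inter> X)) \<le> card ((L \<union> D) \<inter> NS X)"
    by (intro card_mono NL) auto
  have "card (NS X) = card X + 1" using X unfolding tight_def by blast
  \<comment> \<open>Adding the bounds for \<open>K\<close> and \<open>L\<close> counts
    \<open>D \<inter> NS X\<close> twice. Since \<open>D\<close> has at most one element, the total
    only just fits, and all inequalities on the side of \<open>K\<close> are equalities.\<close>
  then have eq: "card (NS (K \<inter> X)) = card (K \<inter> X) + 1"
      "card (NS (K \<inter> X)) = card ((K \<union> D) \<inter> NS X)"
    using split[of X] split[of "NS X"] finX dD cK cL sK sL mK mL by auto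
  have "NS (K \<inter> X) = (K \<union> D) \<inter> NS X"
    by (intro card_subset_eq NK eq(2)) auto
  then have "r \<in> NS (K \<inter> X)" "s \<in> NS (K \<inter> X)" using rs rsK by blast+
  moreover have "tight (K \<inter> X)"
    unfolding tight_def using eq(1) \<open>K \<inter> X \<noteq> {}\<close> tight_subset[OF X] by blast
  ultimately have "card X \<le> card (K \<inter> X)" using minimal by blast
  moreover have "card (L \<inter> X) \<noteq> 0" using \<open>L \<inter> X \<noteq> {}\<close> finX by simp
  ultimately show False using split[of X] finX by simp
qed

text \<open>\<open>D\<close> is empty or a single vertex, which covers connectedness and the
  deletion of a vertex at once. The adjacent vertices \<open>r\<close> and \<open>s\<close> cannot
  lie on opposite sides of a cut, so \<open>minimal_tight_no_cut\<close> applies, if necessary with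
  \<open>K\<close> and \<open>L\<close> exchanged.\<close>

lemma minimal_tight_connected:
  assumes X: "tight X" and rs: "r \<in> NS X" "s \<in> NS X" "r \<rightarrow> s"
    and minimal: "\<And>Y. \<lbrakk>tight Y; r \<in> NS Y; s \<in> NS Y\<rbrakk> \<Longrightarrow> card X \<le> card Y"
    and D: "D \<subseteq> {d}" "D \<subseteq> X \<union> NS X"
  shows "Digraph_Component.connected (G \<restriction> (X \<union> NS X - D))"
proof (rule connected_induceI)
  have sr: "s \<rightarrow> r" using rs(3) adj_commute[of r s] by blast
  have "r \<noteq> s" using rs(3) adj_not_same by blast
  show "X \<union> NS X - D \<subseteq> verts G" using tight_subset_verts[OF X] NS_subset by blast
  show "X \<union> NS X - D \<noteq> {}" using rs D \<open>r \<noteq> s\<close> by blast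
  fix K assume K: "K \<subseteq> X \<union> NS X - D" "K \<noteq> {}" "X \<union> NS X - D - K \<noteq> {}"
    and sep: "\<And>u v. \<lbrakk>u \<in> K; v \<in> X \<union> NS X - D - K\<rbrakk> \<Longrightarrow> \<not> u \<rightarrow> v"
  define L where "L = X \<union> NS X - D - K"
  have part: "K \<union> L \<union> D = X \<union> NS X" "K \<inter> L = {}" "K \<inter> D = {}" "L \<inter> D = {}" "L \<noteq> {}"
    using K D(2) unfolding L_def by blast+
  have sep1: "\<not> u \<rightarrow> v" if "u \<in> K" "v \<in> L" for u v using sep that unfolding L_def by blast
  have sep2: "\<not> v \<rightarrow> u" if "u \<in> K" "v \<in> L" for u v
    using sep1[OF that] adj_commute[of u v] by blast
  have "r \<in> K \<union> L \<union> D" "s \<in> K \<union> L \<union> D" using rs part(1) by blast+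
  then consider "r \<in> K \<union> D" "s \<in> K \<union> D" | "r \<in> L \<union> D" "s \<in> L \<union> D"
    using sep1 sep2 rs(3) sr by blast
  then show False
  proof cases
    case 1
    then show ?thesis
      using minimal_tight_no_cut[OF X rs minimal part(1-4) K(2) part(5) D(1) sep1] by blast
  next
    case 2
    have "L \<union> K \<union> D = X \<union> NS X" "L \<inter> K = {}" using part by blast+
    then show ?thesis
      using minimal_tight_no_cut[OF X rs minimal _ _ part(4,3) part(5) K(2) D(1) sep2] 2 by blast
  qed
qed

lemma minimal_tight_two_connected:
  assumes X: "tight X" and rs: "r \<in> NS X" "s \<in> NS X" "r \<rightarrow> s"
    and minimal: "\<And>Y. \<lbrakk>tight Y; r \<in> NS Y; s \<in> NS Y\<rbrakk> \<Longrightarrow> card X \<le> card Y"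
  shows "two_connected (G \<restriction> (X \<union> NS X))"
proof -
  note conn = minimal_tight_connected[OF X rs minimal]
  have disj: "X \<inter> NS X = {}" using tight_NS_disjoint[OF X] tight_subset[OF X] by blast
  have "card (X \<union> NS X) = card X + card (NS X)"
    using disj tight_finite[OF X] by (intro card_Un_disjoint) auto
  moreover have "card (NS X) = card X + 1" "card X \<noteq> 0"
    using X tight_finite[OF X] unfolding tight_def by auto
  ultimately have "card (X \<union> NS X) > 2" by linarith
  moreover have "Digraph_Component.connected (G \<restriction> (X \<union> NS X))" using conn[of "{}"] by simp
  moreover have "Digraph_Component.connected (G \<restriction> (X \<union> NS X - {v}))" if "v \<in> X \<union> NS X" for v
    using conn[of "{v}" v] that by simp
  ultimately show ?thesis unfolding two_connected_def by (simp add: del_vert_induce)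
qed

section \<open>Assembling the partition from minimal tight sets\<close>

lemma ex_minimal_tight:
  assumes rs: "r \<notin> I" "s \<notin> I" "r \<rightarrow> s"
  obtains X where "tight X" "r \<in> NS X" "s \<in> NS X"
    "\<And>Y. \<lbrakk>tight Y; r \<in> NS Y; s \<in> NS Y\<rbrakk> \<Longrightarrow> card X \<le> card Y"
proof -
  let ?P = "\<lambda>X. tight X \<and> r \<in> NS X \<and> s \<in> NS X"
  obtain X0 where "?P X0" using ex_tight[OF rs] ..
  from ex_has_least_nat[of ?P, OF this, of card]
  obtain X where X: "?P X \<and> (\<forall>Y. ?P Y \<longrightarrow> card X \<le> card Y)" ..
  show ?thesis
  proof (rule that)
    show "tight X" "r \<in> NS X" "s \<in> NS X" using conjunct1[OF X] by simp_all
    show "card X \<le> card Y" if "tight Y" "r \<in> NS Y" "s \<in> NS Y" for Y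
      by (rule mp[OF spec[OF conjunct2[OF X]]]) (intro conjI that)
  qed
qed

lemma special_if_connected:
  assumes conn: "Digraph_Component.connected G"
  shows "special G"
proof -
  define R where "R = verts G - I"
  define E where "E = uedges (G \<restriction> R)"
  have R_sub: "R \<subseteq> verts G" unfolding R_def by blast
  have E: "e \<in> E \<longleftrightarrow> (\<exists>r s. e = {r, s} \<and> r \<in> R \<and> s \<in> R \<and> r \<rightarrow> s)" for e
    unfolding E_def uedges_def by auto
  have finE: "finite E"
  proof -
    interpret H: graph "G \<restriction> R" using R_sub by (rule graph_induce)
    show ?thesis unfolding E_def by (rule H.finite_uedges)
  qed
  have "\<forall>e \<in> E. \<exists>X. tight X \<and> e \<subseteq> NS X \<and> two_connected (G \<restriction> (X \<union> NS X))"
  proof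
    fix e assume "e \<in> E"
    then obtain r s where e: "e = {r, s}" "r \<in> R" "s \<in> R" "r \<rightarrow> s" unfolding E by blast
    then obtain X where X: "tight X" "r \<in> NS X" "s \<in> NS X"
      "\<And>Y. \<lbrakk>tight Y; r \<in> NS Y; s \<in> NS Y\<rbrakk> \<Longrightarrow> card X \<le> card Y"
      using ex_minimal_tight[of r s] unfolding R_def by blast
    then have "two_connected (G \<restriction> (X \<union> NS X))"
      using minimal_tight_two_connected[OF X(1-3) e(4)] by blast
    then show "\<exists>X. tight X \<and> e \<subseteq> NS X \<and> two_connected (G \<restriction> (X \<union> NS X))"
      using X e(1) by blast
  qed
  from bchoice[OF this] obtain X
    where X_all: "\<forall>e \<in> E. tight (X e) \<and> e \<subseteq> NS (X e) \<and> two_connected (G \<restriction> (X e \<union> NS (X e)))" ..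
  have X: "tight (X e)" "e \<subseteq> NS (X e)" and two: "two_connected (G \<restriction> (X e \<union> NS (X e)))"
    if "e \<in> E" for e
    using bspec[OF X_all that] by simp_all
  define Y where "Y e = NS (X e)" for e
  define B where "B e = X e \<union> Y e" for e
  have e_sub: "e \<subseteq> Y e" if "e \<in> E" for e using X(2)[OF that] unfolding Y_def .
  have edge: "\<exists>r s. e = {r, s} \<and> r \<in> Y e \<and> s \<in> Y e \<and> r \<rightarrow> s" if e: "e \<in> E" for e
    using e e_sub[OF e] unfolding E by blast
  have bub: "\<exists>z. bubble (G \<restriction> B e) z (X e) (Y e)" if e: "e \<in> E" for e
  proof -
    obtain r s where "r \<in> Y e" "s \<in> Y e" "r \<rightarrow> s" using edge[OF e] by blast
    then show ?thesis using tight_bubble[OF X(1)[OF e]] unfolding B_def Y_def by metis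
  qed
  have XI: "X e \<subseteq> I" "Y e \<inter> I = {}" if "e \<in> E" for e
    using tight_subset[OF X(1)[OF that]] tight_NS_disjoint[OF X(1)[OF that]] unfolding Y_def .
  \<comment> \<open>If two such neighbourhoods meet, \<open>tight_same_edge\<close> identifies the
    edges they were chosen for.\<close>
  have Y_eq: "e = e'" if e: "e \<in> E" "e' \<in> E" "Y e \<inter> Y e' \<noteq> {}" for e e'
  proof -
    obtain r s where rs: "e = {r, s}" "r \<in> Y e" "s \<in> Y e" "r \<rightarrow> s"
      using edge[OF e(1)] by blast
    obtain r' s' where rs': "e' = {r', s'}" "r' \<in> Y e'" "s' \<in> Y e'" "r' \<rightarrow> s'"
      using edge[OF e(2)] by blast
    have "{r, s} = {r', s'}"
      using tight_same_edge[OF X(1)[OF e(1)] X(1)[OF e(2)], folded Y_def, OF e(3) rs(2-4) rs'(2-4)] .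
    then show ?thesis using rs(1) rs'(1) by simp
  qed
  have adj_Y: "y \<in> Y e" if "x \<in> X e" "y \<rightarrow> x" for e x y
    using that adj_commute[of x y] unfolding Y_def by auto
  \<comment> \<open>Since \<open>X e\<close> lies in \<open>I\<close> and \<open>Y e\<close> outside
    it, an overlap pairs like with like. A common vertex of \<open>X e\<close> and
    \<open>X e'\<close> has a neighbour, which is common to \<open>Y e\<close> and
    \<open>Y e'\<close>.\<close>
  have B_disj: "B e \<inter> B e' = {}" if e: "e \<in> E" "e' \<in> E" "e \<noteq> e'" for e e'
  proof (rule ccontr)
    assume "B e \<inter> B e' \<noteq> {}"
    then have "X e \<inter> X e' \<noteq> {}"
      using Y_eq[OF e(1,2)] e(3) XI[OF e(1)] XI[OF e(2)] unfolding B_def by blast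
    then obtain x where x: "x \<in> X e" "x \<in> X e'" by blast
    then have "card (N x) = 3" using XI(1)[OF e(1)] I_subset card_neighbors by blast
    then have "N x \<noteq> {}" by auto
    then obtain y where "y \<rightarrow> x" using adj_commute[of x] by auto
    then have "Y e \<inter> Y e' \<noteq> {}" using adj_Y x by blast
    then show False using Y_eq[OF e(1,2)] e(3) by blast
  qed
  have B_sub: "B e \<subseteq> verts G" if "e \<in> E" for e
    using XI(1)[OF that] I_subset NS_subset[of "X e"] unfolding B_def Y_def by blast
  obtain h where h: "bij_betw h {1..card E} E"
    using ex_bij_betw_nat_finite_1[OF finE] by blast
  have hE: "h i \<in> E" if "i \<in> {1..card E}" for i using h that unfolding bij_betw_def by blast
  \<comment> \<open>Bubbles are numbered from 1 along \<open>h\<close>; index 0 is reserved for the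
    vertices in no bubble.\<close>
  define V where "V i = (if i = 0 then verts G - (\<Union>e \<in> E. B e) else B (h i))" for i :: nat
  have V0: "V 0 = verts G - (\<Union>e \<in> E. B e)" and Vi: "\<And>i. i \<in> {1..card E} \<Longrightarrow> V i = B (h i)"
    unfolding V_def by auto
  have V0_sub: "V 0 \<subseteq> verts G" unfolding V0 by blast
  have UV: "(\<Union>i \<in> {0..card E}. V i) = verts G"
  proof -
    have "{0..card E} = insert 0 {1..card E}" by auto
    then have "(\<Union>i \<in> {0..card E}. V i) = V 0 \<union> (\<Union>i \<in> {1..card E}. B (h i))"
      using Vi by simp
    also have "(\<Union>i \<in> {1..card E}. B (h i)) = (\<Union>e \<in> h ` {1..card E}. B e)" by simp
    also have "h ` {1..card E} = E" using h unfolding bij_betw_def by blast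
    finally show ?thesis using B_sub unfolding V0 by blast
  qed
  have disjV: "disjoint_family_on V {0..card E}"
    unfolding disjoint_family_on_def
  proof (intro ballI impI)
    fix i j assume ij: "i \<in> {0..card E}" "j \<in> {0..card E}" "i \<noteq> j"
    show "V i \<inter> V j = {}"
    proof (cases "i = 0 \<or> j = 0")
      case True
      then show ?thesis using ij hE[of i] hE[of j] unfolding V_def by auto
    next
      case False
      then have "h i \<noteq> h j"
        using ij h inj_onD[of h "{1..card E}" i j] unfolding bij_betw_def by auto
      then show ?thesis using B_disj hE[of i] hE[of j] Vi[of i] Vi[of j] ij False by auto
    qed
  qed
  have no_edge_V0: "\<not> u \<rightarrow> v" if "u \<in> R" "v \<in> R" "u \<in> V 0" for u v
  proof
    assume "u \<rightarrow> v"
    then have e: "{u, v} \<in> E" using that E by blast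
    then have "u \<in> B {u, v}" using e_sub[OF e] unfolding B_def by blast
    then show False using e that(3) unfolding V0 by blast
  qed
  have bip: "bipartition (G \<restriction> V 0) (I \<inter> V 0) (R \<inter> V 0)"
    unfolding bipartition_def
  proof (intro conjI)
    show "I \<inter> V 0 \<union> R \<inter> V 0 = verts (G \<restriction> V 0)" using V0_sub unfolding R_def by auto
    show "I \<inter> V 0 \<inter> (R \<inter> V 0) = {}" unfolding R_def by blast
    show "independent_set (G \<restriction> V 0) (I \<inter> V 0)"
      using independent_set_mono[OF indep Int_lower1] by (simp add: independent_set_induce[OF V0_sub])
    have "independent_set G (R \<inter> V 0)"
      using no_edge_V0 V0_sub unfolding independent_set_def by blast
    then show "independent_set (G \<restriction> V 0) (R \<inter> V 0)"
      by (simp add: independent_set_induce[OF V0_sub])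
  qed
  \<comment> \<open>A neighbour of \<open>v\<close> lies in \<open>I\<close> by
    \<open>no_edge_V0\<close>. If it were in some \<open>X e\<close>, then \<open>v\<close> would be
    in \<open>Y e\<close> and so not in \<open>V 0\<close>.\<close>
  have deg: "out_degree (G \<restriction> V 0) v = 3" if v: "v \<in> R \<inter> V 0" for v
  proof -
    have "u \<in> V 0" if u: "v \<rightarrow> u" for u
    proof -
      have "u \<in> verts G" using u adj_in_verts by blast
      then have "u \<in> I" using no_edge_V0[of v u] u v unfolding R_def by blast
      have "u \<notin> B e" if e: "e \<in> E" for e
      proof
        assume "u \<in> B e"
        then have "u \<in> X e" using XI(2)[OF e] \<open>u \<in> I\<close> unfolding B_def by blast
        then have "v \<in> B e" using adj_Y[of u e v] u unfolding B_def by blast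
        then show False using v e unfolding V0 by blast
      qed
      then show ?thesis using \<open>u \<in> verts G\<close> unfolding V0 by blast
    qed
    then have "N v \<inter> V 0 = N v" by auto
    then show ?thesis using v V0_sub card_neighbors by (auto simp: out_degree_induce)
  qed
  \<comment> \<open>If there is a bubble, the vertex \<open>w\<close> at which its outgoing edge
    \<open>zw\<close> ends lies in \<open>V 0\<close>. First, \<open>w \<in> I\<close>: otherwise
    \<open>zw\<close> would be an edge outside \<open>I\<close>, equal to \<open>e\<close> by
    \<open>Y_eq\<close> because \<open>z\<close> is in both neighbourhoods, and \<open>w\<close>
    would be in \<open>Y e\<close>. Second, if \<open>w\<close> were in some \<open>X e'\<close>,
    then \<open>z\<close> would be in \<open>Y e'\<close>, forcing \<open>e' = e\<close> against
    \<open>w \<notin> X e\<close>.\<close>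
  have V0_ne: "V 0 \<noteq> {}"
  proof (cases "E = {}")
    case True
    then show ?thesis using conn unfolding V0 connected_iff_closed_sets by simp
  next
    case False
    then obtain e where e: "e \<in> E" by blast
    obtain r s where "r \<in> Y e" "s \<in> Y e" and rs: "r \<rightarrow> s" using edge[OF e] by blast
    then obtain z w where zw: "z \<in> Y e" "w \<notin> X e" "w \<notin> Y e" "z \<rightarrow> w"
      using tight_slack[OF X(1)[OF e] _ _ rs] unfolding Y_def by metis
    have verts: "z \<in> verts G" "w \<in> verts G" using zw(4) adj_in_verts by blast+
    have "w \<in> I"
    proof (rule ccontr)
      assume "w \<notin> I"
      moreover have "z \<notin> I" using zw(1) XI(2)[OF e] by blast
      ultimately have e': "{z, w} \<in> E" using verts zw(4) unfolding E R_def by blast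
      then have "e = {z, w}" using Y_eq[OF e e'] e_sub[OF e'] zw(1) by blast
      then show False using e_sub[OF e] zw(3) by blast
    qed
    have "w \<notin> B e'" if e': "e' \<in> E" for e'
    proof
      assume "w \<in> B e'"
      then have "w \<in> X e'" using XI(2)[OF e'] \<open>w \<in> I\<close> unfolding B_def by blast
      then have "e = e'" using Y_eq[OF e e'] adj_Y[of w e' z] zw(1,4) by blast
      then show False using \<open>w \<in> X e'\<close> zw(2) by blast
    qed
    then show ?thesis using verts(2) unfolding V0 by blast
  qed
  have parts: "two_connected (G \<restriction> V i) \<and> (\<exists>z I R. bubble (G \<restriction> V i) z I R)"
    if "i \<in> {1..card E}" for i
    using two[OF hE[OF that]] bub[OF hE[OF that]] unfolding Vi[OF that] B_def Y_def by blast
  have "graph G" by unfold_locales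
  then show ?thesis
    unfolding special_def
    by (intro conjI exI[of _ "card E"] exI[of _ V] exI[of _ "I \<inter> V 0"] exI[of _ "R \<inter> V 0"]
        ballI conn cubic UV disjV V0_ne bip deg conjunct1[OF parts] conjunct2[OF parts])
qed

end

theorem theorem2:
  fixes G :: "('a, 'b) pre_digraph"
  assumes "graph G" and "Digraph_Component.connected G" and "cubic G"
  shows "independence_number G = matching_number G \<longleftrightarrow> special G"
proof -
  interpret cubic_graph G
    using assms(1,3) by (simp add: cubic_graph_def cubic_graph_axioms_def)
  show ?thesis
  proof
    assume "special G"
    then show "independence_number G = matching_number G"
      using matching_le_independence_if_special independence_le_matching by (simp add: le_antisym)
  next
    assume eq: "independence_number G = matching_number G"
    obtain I where I: "independent_set G I" "card I = independence_number G"
      by (rule maximum_independent_set)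
    show "special G"
    \<comment> \<open>The negation of the case condition is the strict Hall condition of
      \<open>surplus_graph\<close>, and \<open>eq\<close> supplies its assumption on
      \<open>card I\<close>.\<close>
    proof (cases "\<exists>X \<subseteq> I. X \<noteq> {} \<and> card (NS X) \<le> card X")
      case True
      then obtain X where X: "X \<subseteq> I" "X \<noteq> {}" "card (NS X) \<le> card X" by blast
      have "independent_set G X" using I(1) X(1) by (rule independent_set_mono)
      then show ?thesis using special_if_no_surplus[OF assms(2)] X by blast
    next
      case False
      then interpret surplus_graph G I
        using I eq by unfold_locales (auto simp: not_le)
      show ?thesis using assms(2) by (rule special_if_connected)
    qed
  qed
qed

end
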